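(* Let $X$ be a continuous vector field on $\mathbb{S}^1$. Then the infinitesimal Douady-Earle extension $L_0(X)$ is a harmonic Lagrangian vector field on $\mathbb{B}^2$.
   Context: $\mathbb{B}^2\subset\mathbb{C}$ is the Poincaré disk model of the hyperbolic plane: the unit disk with metric $g_z=\frac{4}{(1-|z|^2)^2}|dz|^2$, Levi-Civita connection $\nabla$ and complex structure $\mathrm{J}$ given by multiplication by $i$. For a continuous vector field $X$ on $\mathbb{S}^1$ (tangent to $\mathbb{S}^1$, regarded as a $\mathbb{C}$-valued function), $$L_0(X)(z)=\frac{(1-|z|^2)^3}{2i\pi}\int_{\mathbb{S}^1}\frac{X(x)}{(1-\overline{z}x)^3(x-z)}\,dx,\qquad z\in\mathbb{B}^2,$$ where $dx$ is the complex line element and $\mathbb{S}^1$ is oriented counterclockwise. For $(x,v)\in \mathrm{T}\mathbb{B}^2$, identify $\mathrm{T}_x\mathbb{B}^2\times \mathrm{T}_x\mathbb{B}^2\cong \mathrm{T}_{(x,v)}\mathrm{T}\mathbb{B}^2$ by $(w_1,w_2)\mapsto w_1^{\mathcal{H}}+w_2^{\mathcal{V}}$ (horizontal lift of $w_1$ with respect to $\nabla$ plus vertical lift of $w_2$). Put $\mathbb{G}((X_1,X_2),(Y_1,Y_2))=g(X_1,Y_2)+g(X_2,Y_1)$ (pseudo-Riemannian metric of signature $(2,2)$) and $\Omega((X_1,X_2),(Y_1,Y_2))=g(\mathrm{J}X_1,Y_2)-g(X_2,\mathrm{J}Y_1)$ (symplectic form). A smooth vector field $V$ is harmonic Lagrangian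 if $V:(\mathbb{B}^2,g)\to(\mathrm{T}\mathbb{B}^2,\mathbb{G})$ is a harmonic map (vanishing tension field $\mathrm{tr}_g\nabla^2V$, with $\nabla^2V(X,Y)=\nabla^{\mathbb{G}}_{\mathrm{d}V(X)}\mathrm{d}V(Y)-\mathrm{d}V(\nabla_XY)$) and $V(\mathbb{B}^2)$ is Lagrangian for $\Omega$ ($V^*\Omega=0$). *)

theory Defs
  imports "HOL-Complex_Analysis.Complex_Analysis"
begin

text \<open>For open \<open>S\<close> in a Euclidean space, \<open>Ck_on k S f\<close> says that \<open>f\<close> is of class \<open>C\<^sup>k\<close> on \<open>S\<close> in
  the real sense: all iterated directional derivatives up to order \<open>k\<close> exist and are continuous.\<close>

primrec Ck_on :: "nat \<Rightarrow> 'a::euclidean_space set \<Rightarrow> ('a \<Rightarrow> 'b::euclidean_space) \<Rightarrow> bool" where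
  "Ck_on 0 S f = continuous_on S f"
| "Ck_on (Suc k) S f =
     ((\<forall>x\<in>S. f differentiable (at x)) \<and> (\<forall>v. Ck_on k S (\<lambda>x. frechet_derivative f (at x) v)))"

definition smooth_on :: "'a::euclidean_space set \<Rightarrow> ('a \<Rightarrow> 'b::euclidean_space) \<Rightarrow> bool" where
  "smooth_on S f \<longleftrightarrow> (\<forall>k. Ck_on k S f)"

text \<open>A pseudo-Riemannian metric on an open subset of a Euclidean space \<open>'a\<close>: the value at the point
  \<open>p\<close> on the tangent vectors \<open>X\<close>, \<open>Y\<close> is \<open>h p X Y\<close>. Only points of the open set in question are
  ever used.\<close>

type_synonym 'a metric_field = "'a \<Rightarrow> 'a \<Rightarrow> 'a \<Rightarrow> real"

text \<open>The Levi-Civita connection in the global chart is \<open>\<nabla>\<^sub>X Y = DY(X) + \<Gamma>(X, Y)\<close>. Evaluated on constant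
  vector fields, torsion-freeness is symmetry of \<open>\<Gamma>\<close> and compatibility with the metric is
  \<open>X h(Y, Z) = h(\<nabla>\<^sub>X Y, Z) + h(Y, \<nabla>\<^sub>X Z)\<close>; these two conditions determine \<open>\<Gamma>\<close> uniquely.\<close>

definition levi_civita_at :: "'a::euclidean_space metric_field \<Rightarrow> 'a \<Rightarrow> ('a \<Rightarrow> 'a \<Rightarrow> 'a) \<Rightarrow> bool" where
  "levi_civita_at h p \<Gamma> \<longleftrightarrow>
     bilinear \<Gamma> \<and>
     (\<forall>X Y. \<Gamma> X Y = \<Gamma> Y X) \<and>
     (\<forall>X Y Z. frechet_derivative (\<lambda>q. h q Y Z) (at p) X = h p (\<Gamma> X Y) Z + h p Y (\<Gamma> X Z))"

definition christoffel :: "'a::euclidean_space metric_field \<Rightarrow> 'a \<Rightarrow> 'a \<Rightarrow> 'a \<Rightarrow> 'a" where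
  "christoffel h p = (THE \<Gamma>. levi_civita_at h p \<Gamma>)"

text \<open>The pull-back connection: covariant derivative at \<open>p\<close>, in direction \<open>u\<close>, of a vector field \<open>W\<close>
  along the map \<open>f\<close>, where \<open>h\<close> is the metric on the target. The case \<open>f = id\<close> is the
  Levi-Civita connection itself.\<close>

definition cov_along ::
    "'b::euclidean_space metric_field \<Rightarrow> ('a::euclidean_space \<Rightarrow> 'b) \<Rightarrow> ('a \<Rightarrow> 'b) \<Rightarrow> 'a \<Rightarrow> 'a \<Rightarrow> 'b" where
  "cov_along h f W p u =
     frechet_derivative W (at p) u + christoffel h (f p) (frechet_derivative f (at p) u) (W p)"

abbreviation cov :: "'a::euclidean_space metric_field \<Rightarrow> ('a \<Rightarrow> 'a) \<Rightarrow> 'a \<Rightarrow> 'a \<Rightarrow> 'a" where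
  "cov g \<equiv> cov_along g (\<lambda>p. p)"

definition map_hessian ::
    "'a::euclidean_space metric_field \<Rightarrow> 'b::euclidean_space metric_field \<Rightarrow> ('a \<Rightarrow> 'b)
      \<Rightarrow> ('a \<Rightarrow> 'a) \<Rightarrow> ('a \<Rightarrow> 'a) \<Rightarrow> 'a \<Rightarrow> 'b" where
  "map_hessian g h f X Y p =
     cov_along h f (\<lambda>q. frechet_derivative f (at q) (Y q)) p (X p)
     - frechet_derivative f (at p) (cov g Y p (X p))"

definition orthonormal_frame :: "('a::euclidean_space \<Rightarrow> 'a \<Rightarrow> real) \<Rightarrow> 'a set \<Rightarrow> bool" where
  "orthonormal_frame b E \<longleftrightarrow>
     card E = DIM('a) \<and> (\<forall>e\<in>E. \<forall>e'\<in>E. b e e' = (if e = e' then 1 else 0))"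

text \<open>Trace of a bilinear map \<open>T\<close> with respect to an inner product \<open>b\<close>: the common value of
  \<open>\<Sum>e. T e e\<close> over all \<open>b\<close>-orthonormal bases.\<close>

definition metric_trace ::
    "('a::euclidean_space \<Rightarrow> 'a \<Rightarrow> real) \<Rightarrow> ('a \<Rightarrow> 'a \<Rightarrow> 'b::euclidean_space) \<Rightarrow> 'b" where
  "metric_trace b T = (THE t. \<forall>E. orthonormal_frame b E \<longrightarrow> t = (\<Sum>e\<in>E. T e e))"

text \<open>\<open>map_hessian\<close> is tensorial, so tangent vectors at \<open>p\<close> may be extended to constant vector fields.\<close>

definition tension ::
    "'a::euclidean_space metric_field \<Rightarrow> 'b::euclidean_space metric_field \<Rightarrow> ('a \<Rightarrow> 'b) \<Rightarrow> 'a \<Rightarrow> 'b" where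
  "tension g h f p = metric_trace (g p) (\<lambda>u v. map_hessian g h f (\<lambda>_. u) (\<lambda>_. v) p)"

definition harmonic_map_on ::
    "'a::euclidean_space set \<Rightarrow> 'a metric_field \<Rightarrow> 'b::euclidean_space metric_field \<Rightarrow> ('a \<Rightarrow> 'b) \<Rightarrow> bool" where
  "harmonic_map_on U g h f \<longleftrightarrow> smooth_on U f \<and> (\<forall>p\<in>U. tension g h f p = 0)"

abbreviation disk :: "complex set" where
  "disk \<equiv> ball 0 1"

definition hyp_metric :: "complex metric_field" where
  "hyp_metric z u v = 4 / (1 - (cmod z)\<^sup>2)\<^sup>2 * (u \<bullet> v)"

definition J :: "complex \<Rightarrow> complex" where
  "J w = \<i> * w"

text \<open>The tangent bundle of the disk is \<open>disk \<times> UNIV\<close>, an open subset of \<open>complex \<times> complex\<close>.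
  The horizontal lift of \<open>w\<close> at \<open>(x, v)\<close> is the initial velocity of \<open>t \<mapsto> (c t, P t)\<close>, where \<open>c\<close> is a
  curve with \<open>c' 0 = w\<close> and \<open>P\<close> is the parallel transport of \<open>v\<close> along \<open>c\<close>, so that
  \<open>P' + \<Gamma>(c', P) = 0\<close>.\<close>

definition horizontal_lift :: "complex \<times> complex \<Rightarrow> complex \<Rightarrow> complex \<times> complex" where
  "horizontal_lift = (\<lambda>(x, v) w. (w, - christoffel hyp_metric x w v))"

definition vertical_lift :: "complex \<times> complex \<Rightarrow> complex \<Rightarrow> complex \<times> complex" where
  "vertical_lift = (\<lambda>(x, v) w. (0, w))"

definition lift :: "complex \<times> complex \<Rightarrow> complex \<times> complex \<Rightarrow> complex \<times> complex" where
  "lift p = (\<lambda>(w\<^sub>1, w\<^sub>2). horizontal_lift p w\<^sub>1 + vertical_lift p w\<^sub>2)"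

text \<open>\<open>components p\<close> recovers \<open>(w\<^sub>1, w\<^sub>2)\<close> from the tangent vector \<open>w\<^sub>1\<^sup>H + w\<^sub>2\<^sup>V\<close> at \<open>p\<close>.\<close>

definition components :: "complex \<times> complex \<Rightarrow> complex \<times> complex \<Rightarrow> complex \<times> complex" where
  "components p = inv (lift p)"

definition tangent_metric :: "(complex \<times> complex) metric_field" where
  "tangent_metric p A B =
     (let (X\<^sub>1, X\<^sub>2) = components p A; (Y\<^sub>1, Y\<^sub>2) = components p B
      in hyp_metric (fst p) X\<^sub>1 Y\<^sub>2 + hyp_metric (fst p) X\<^sub>2 Y\<^sub>1)"

definition tangent_symplectic ::
    "complex \<times> complex \<Rightarrow> complex \<times> complex \<Rightarrow> complex \<times> complex \<Rightarrow> real" where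
  "tangent_symplectic p A B =
     (let (X\<^sub>1, X\<^sub>2) = components p A; (Y\<^sub>1, Y\<^sub>2) = components p B
      in hyp_metric (fst p) (J X\<^sub>1) Y\<^sub>2 - hyp_metric (fst p) X\<^sub>2 (J Y\<^sub>1))"

definition section_of :: "(complex \<Rightarrow> complex) \<Rightarrow> complex \<Rightarrow> complex \<times> complex" where
  "section_of V z = (z, V z)"

text \<open>The image of a section is always an embedded surface in the four-dimensional tangent bundle, so
  it is Lagrangian precisely when the symplectic form pulls back to zero.\<close>

definition lagrangian_section :: "(complex \<Rightarrow> complex) \<Rightarrow> bool" where
  "lagrangian_section V \<longleftrightarrow>
     (\<forall>z\<in>disk. \<forall>u v. tangent_symplectic (section_of V z)
        (frechet_derivative (section_of V) (at z) u)
        (frechet_derivative (section_of V) (at z) v) = 0)"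

definition harmonic_lagrangian :: "(complex \<Rightarrow> complex) \<Rightarrow> bool" where
  "harmonic_lagrangian V \<longleftrightarrow>
     smooth_on disk V \<and>
     harmonic_map_on disk hyp_metric tangent_metric (section_of V) \<and>
     lagrangian_section V"

text \<open>Vector fields on the unit circle are complex-valued functions tangent to the circle.\<close>

definition continuous_circle_field :: "(complex \<Rightarrow> complex) \<Rightarrow> bool" where
  "continuous_circle_field X \<longleftrightarrow>
     continuous_on (sphere 0 1) X \<and> (\<forall>x\<in>sphere 0 1. X x \<bullet> x = 0)"

definition L0 :: "(complex \<Rightarrow> complex) \<Rightarrow> complex \<Rightarrow> complex" where
  "L0 X z =
     of_real ((1 - (cmod z)\<^sup>2) ^ 3) / (2 * \<i> * of_real pi) *
     contour_integral (circlepath 0 1) (\<lambda>x. X x / ((1 - cnj z * x) ^ 3 * (x - z)))"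

end

theory Submission
  imports Defs
begin

text \<open>
  Everything is computed in the coordinate \<open>z\<close> of the disk, with derivatives \<open>\<partial>/\<partial>z\<close> and \<open>\<partial>/\<partial>\<zeta>\<close>, where
  \<open>\<zeta> = cnj z\<close>. The hyperbolic metric is \<open>\<lambda> |dz|\<^sup>2\<close> with \<open>\<lambda> = 4 / s\<^sup>2\<close> and \<open>s = 1 - |z|\<^sup>2\<close>; its Christoffel
  form is \<open>\<Gamma>(u, v) = \<phi> u v\<close> with \<open>\<phi> = 2 \<zeta> / s\<close>.

  Geometry. The neutral metric on the tangent bundle is the complete lift of the hyperbolic metric,
  and its Christoffel form is the complete lift of \<open>\<Gamma>\<close> (\<open>christoffel_tangent_metric\<close>). Write \<open>p\<close> and \<open>q\<close>
  for the derivatives of a vector field \<open>V\<close> with respect to \<open>z\<close> and \<open>\<zeta>\<close>. The Hessian of the section \<open>V\<close>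
  is vertical, and in its trace only the coefficient of \<open>|u|\<^sup>2\<close> survives, because \<open>e\<^sup>2 + f\<^sup>2 = 0\<close> for an
  orthonormal frame \<open>e, f\<close>. So \<open>V\<close> is harmonic as soon as \<open>\<partial>q/\<partial>z + \<phi> q = 0\<close>, i.e. as soon as \<open>q / s\<^sup>2\<close>
  is antiholomorphic (\<open>tension_section_of_eq_0\<close>), and it is Lagrangian if \<open>p + \<phi> V\<close> is
  purely imaginary, i.e. if \<open>V\<close> is divergence free (\<open>lagrangian_sectionI\<close>).

  Analysis. Let \<open>V = L0 X\<close>, \<open>y = x - z\<close> and \<open>w = 1 - \<zeta> x\<close>. Then \<open>s = \<zeta> y + w\<close>, and partial fractions turn
  the kernel \<open>s\<^sup>3 / (w\<^sup>3 y)\<close> into a combination of \<open>1 / y\<close> and powers of \<open>1 / w\<close> without denominators in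
  \<open>s\<close> (\<open>L0_eq\<close>). Hence \<open>V\<close> is a polynomial in \<open>z\<close>, \<open>\<zeta>\<close>, holomorphic functions of \<open>z\<close> and holomorphic functions
  of \<open>\<zeta>\<close>; it is smooth, and its derivatives are found by algebra. They are what differentiation under
  the integral would give: \<open>q\<close> has the kernel \<open>3 s\<^sup>2 / w\<^sup>4\<close>, in which \<open>z\<close> occurs only in the factor
  \<open>s\<^sup>2\<close> (\<open>has_wirtinger_L0\<close>), and \<open>p + \<phi> V\<close> has the kernel \<open>s\<^sup>2 / (w y)\<^sup>2\<close>. On the circle \<open>w = x cnj y\<close>, so \<open>w y\<close>
  is \<open>x\<close> times a real number; for a tangential \<open>X\<close> this makes the integral real, and the prefactor
  \<open>1 / (2 \<pi> \<i>)\<close> makes \<open>p + \<phi> V\<close> imaginary (\<open>Re_L0_dz_eq_0\<close>).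
\<close>

section \<open>Levi-Civita connections\<close>

text \<open>Koszul's uniqueness argument. The difference of two solutions, lowered with the metric, is a
  trilinear form that is symmetric in its first two and antisymmetric in its last two arguments;
  such a form vanishes. Nondegeneracy, which also holds for the metric of signature \<open>(2, 2)\<close> on the
  tangent bundle, then gives equality.\<close>

lemma christoffel_eqI:
  fixes h :: "'a::euclidean_space metric_field"
  assumes lc: "levi_civita_at h p \<Gamma>"
    and bil: "bilinear (h p)"
    and sym: "\<And>Y Z. h p Y Z = h p Z Y"
    and nondeg: "\<And>W. (\<And>Z. h p W Z = 0) \<Longrightarrow> W = 0"
  shows "christoffel h p = \<Gamma>"
  unfolding christoffel_def
proof (rule the_equality)
  show "levi_civita_at h p \<Gamma>" by (rule lc)
next
  fix \<Delta> assume lc': "levi_civita_at h p \<Delta>"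
  define T where "T = (\<lambda>X Y Z. h p (\<Delta> X Y - \<Gamma> X Y) Z)"
  have T_sym: "T X Y Z = T Y X Z" for X Y Z
    using lc lc' by (simp add: T_def levi_civita_at_def)
  \<comment> \<open>Both solutions satisfy the compatibility equation with the same left-hand side.\<close>
  have T_anti: "T X Y Z = - T X Z Y" for X Y Z
  proof -
    have "h p (\<Delta> X Y) Z + h p Y (\<Delta> X Z) = h p (\<Gamma> X Y) Z + h p Y (\<Gamma> X Z)"
      using lc lc' unfolding levi_civita_at_def by metis
    then show ?thesis
      by (simp add: T_def bilinear_lsub[OF bil] sym[of Y])
  qed
  \<comment> \<open>The symmetries generate all transpositions; going round \<open>X, Y, Z\<close> produces an odd number of signs.\<close>
  have "T X Y Z = 0" for X Y Z
    using T_sym[of X Y Z] T_anti[of Y X Z] T_sym[of Y Z X] T_anti[of Z Y X] T_sym[of Z X Y]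
      T_anti[of X Z Y] by linarith
  then have "\<Delta> X Y - \<Gamma> X Y = 0" for X Y
    unfolding T_def by (intro nondeg)
  then show "\<Delta> = \<Gamma>"
    by (auto simp: fun_eq_iff)
qed

section \<open>Wirtinger derivatives\<close>

text \<open>\<open>a\<close> and \<open>b\<close> are the derivatives \<open>\<partial>f/\<partial>z\<close> and \<open>\<partial>f/\<partial>\<zeta>\<close> with \<open>\<zeta> = cnj z\<close>. In this form the real
  differential of a polynomial in holomorphic and antiholomorphic functions can be computed by
  algebra over the complex numbers.\<close>

definition has_wirtinger :: "(complex \<Rightarrow> complex) \<Rightarrow> complex \<Rightarrow> complex \<Rightarrow> complex \<Rightarrow> bool" where
  "has_wirtinger f a b z \<longleftrightarrow> (f has_derivative (\<lambda>u. a * u + b * cnj u)) (at z)"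

lemma has_wirtinger_eq:
  assumes "has_wirtinger f a b z" "a = a'" "b = b'"
  shows "has_wirtinger f a' b' z"
  using assms by simp

lemma has_wirtinger_const: "has_wirtinger (\<lambda>z. c) 0 0 z"
  by (simp add: has_wirtinger_def)

lemma has_wirtinger_ident: "has_wirtinger (\<lambda>z. z) 1 0 z"
  by (simp add: has_wirtinger_def)

lemma has_wirtinger_cnj:
  assumes "has_wirtinger f a b z"
  shows "has_wirtinger (\<lambda>z. cnj (f z)) (cnj b) (cnj a) z"
  using has_derivative_cnj[OF assms[unfolded has_wirtinger_def]]
  by (simp add: has_wirtinger_def add.commute)

lemma has_wirtinger_add:
  assumes "has_wirtinger f a b z" "has_wirtinger g c d z"
  shows "has_wirtinger (\<lambda>z. f z + g z) (a + c) (b + d) z"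
  using has_derivative_add[OF assms[unfolded has_wirtinger_def]]
  by (simp add: has_wirtinger_def algebra_simps)

lemma has_wirtinger_diff:
  assumes "has_wirtinger f a b z" "has_wirtinger g c d z"
  shows "has_wirtinger (\<lambda>z. f z - g z) (a - c) (b - d) z"
  using has_derivative_diff[OF assms[unfolded has_wirtinger_def]]
  by (simp add: has_wirtinger_def algebra_simps)

lemma has_wirtinger_mult:
  assumes "has_wirtinger f a b z" "has_wirtinger g c d z"
  shows "has_wirtinger (\<lambda>z. f z * g z) (f z * c + a * g z) (f z * d + b * g z) z"
  using has_derivative_mult[OF assms[unfolded has_wirtinger_def]]
  by (simp add: has_wirtinger_def algebra_simps)

lemma has_wirtinger_DERIV:
  assumes "(f has_field_derivative a) (at z)"
  shows "has_wirtinger f a 0 z"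
  using assms by (simp add: has_wirtinger_def has_field_derivative_def)

lemma has_wirtinger_comp_DERIV:
  assumes "(F has_field_derivative d) (at (f z))" "has_wirtinger f a b z"
  shows "has_wirtinger (\<lambda>z. F (f z)) (d * a) (d * b) z"
  using has_derivative_compose[OF assms(2)[unfolded has_wirtinger_def] assms(1)[unfolded has_field_derivative_def]]
  by (simp add: has_wirtinger_def algebra_simps)

section \<open>The Levi-Civita connection of the disk\<close>

text \<open>The coefficient \<open>\<partial>(ln \<lambda>)/\<partial>z\<close> of the Levi-Civita connection of the conformal metric \<open>\<lambda> |dz|\<^sup>2\<close>, where
  \<open>\<lambda>\<close> is the factor \<open>conf\<close>.\<close>

definition \<phi> :: "complex \<Rightarrow> complex" where
  "\<phi> z = 2 * cnj z / (1 - z * cnj z)"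

definition conf :: "complex \<Rightarrow> real" where
  "conf z = 4 / (1 - (cmod z)\<^sup>2)\<^sup>2"

lemma one_minus_mult_cnj_ne_0:
  assumes "z \<in> disk" shows "1 - z * cnj z \<noteq> 0"
proof -
  have "cmod z ^ 2 < 1" using assms by (simp add: abs_square_less_1)
  then show ?thesis
    by (metis complex_norm_square eq_iff_diff_eq_0 less_irrefl of_real_1 of_real_eq_iff)
qed

lemma has_wirtinger_one_minus_mult_cnj:
  "has_wirtinger (\<lambda>z. 1 - z * cnj z) (- cnj z) (- z) z"
  using has_wirtinger_diff[OF has_wirtinger_const[of 1 z]
      has_wirtinger_mult[OF has_wirtinger_ident has_wirtinger_cnj[OF has_wirtinger_ident]]]
  by simp

lemma has_wirtinger_\<phi>:
  assumes "z \<in> disk"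
  shows "has_wirtinger \<phi> (2 * (cnj z)\<^sup>2 / (1 - z * cnj z)\<^sup>2) (2 / (1 - z * cnj z)\<^sup>2) z"
proof -
  define s where "s = 1 - z * cnj z"
  have s: "s \<noteq> 0" "cnj z * z = 1 - s"
    using one_minus_mult_cnj_ne_0[OF assms] by (simp_all add: s_def mult.commute)
  have "has_wirtinger (\<lambda>z. (2 * cnj z) * inverse (1 - z * cnj z))
     (2 * cnj z * (- (inverse s ^ Suc (Suc 0)) * - cnj z) + 0 * inverse s)
     (2 * cnj z * (- (inverse s ^ Suc (Suc 0)) * - z) + 2 * inverse s) z"
    using has_wirtinger_mult[OF
          has_wirtinger_mult[OF has_wirtinger_const[of 2 z] has_wirtinger_cnj[OF has_wirtinger_ident[of z]]]
          has_wirtinger_comp_DERIV[OF DERIV_inverse[OF s(1)[unfolded s_def]] has_wirtinger_one_minus_mult_cnj]]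
    by (simp add: s_def)
  moreover have "2 * cnj z * (- (inverse s ^ Suc (Suc 0)) * - z) + 2 * inverse s = 2 / s\<^sup>2"
  proof -
    have "2 * cnj z * (- (inverse s ^ Suc (Suc 0)) * - z) = 2 * (cnj z * z) / s\<^sup>2"
      by (simp add: power2_eq_square divide_inverse)
    then show ?thesis
      unfolding s(2) using s(1) by (simp add: field_simps power2_eq_square)
  qed
  moreover have "2 * cnj z * (- (inverse s ^ Suc (Suc 0)) * - cnj z) + 0 * inverse s = 2 * (cnj z)\<^sup>2 / s\<^sup>2"
    by (simp add: power2_eq_square divide_inverse)
  ultimately have "has_wirtinger (\<lambda>z. (2 * cnj z) * inverse (1 - z * cnj z)) (2 * (cnj z)\<^sup>2 / s\<^sup>2) (2 / s\<^sup>2) z"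
    by (simp only:)
  then show ?thesis
    by (simp add: \<phi>_def[abs_def] divide_inverse s_def)
qed

lemma of_real_conf: "of_real (conf z) = 4 / (1 - z * cnj z)\<^sup>2"
  by (simp add: conf_def flip: complex_norm_square)

lemma conf_pos: assumes "z \<in> disk" shows "conf z > 0"
proof -
  have "(cmod z)\<^sup>2 < 1" using assms by (simp add: abs_square_less_1)
  then show ?thesis by (simp add: conf_def)
qed

lemma has_derivative_conf:
  assumes "z \<in> disk"
  shows "(conf has_derivative (\<lambda>u. 2 * conf z * Re (\<phi> z * u))) (at z)"
proof -
  note nz = one_minus_mult_cnj_ne_0[OF assms]
  have d: "((\<lambda>w. 4 / w\<^sup>2) has_field_derivative (- 8 / (1 - z * cnj z)^3)) (at (1 - z * cnj z))"
    using nz by (auto intro!: derivative_eq_intros simp: divide_simps eval_nat_numeral)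
  have "has_wirtinger (\<lambda>z. of_real (conf z)) (8 * cnj z / (1 - z * cnj z)^3) (8 * z / (1 - z * cnj z)^3) z"
    using has_wirtinger_comp_DERIV[OF d has_wirtinger_one_minus_mult_cnj]
    unfolding of_real_conf by simp
  from has_derivative_Re[OF this[unfolded has_wirtinger_def]]
  have "(conf has_derivative (\<lambda>u. Re (8 * cnj z / (1 - z * cnj z)^3 * u + 8 * z / (1 - z * cnj z)^3 * cnj u))) (at z)"
    by simp
  also have "(\<lambda>u. Re (8 * cnj z / (1 - z * cnj z)^3 * u + 8 * z / (1 - z * cnj z)^3 * cnj u))
     = (\<lambda>u. 2 * conf z * Re (\<phi> z * u))"
  proof
    fix u
    have "complex_of_real (2 * conf z * Re (\<phi> z * u)) = of_real (conf z) * (\<phi> z * u + cnj (\<phi> z * u))"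
      by (simp only: complex_add_cnj of_real_mult of_real_numeral mult.assoc mult.left_commute)
    also have "\<dots> = 8 * cnj z / (1 - z * cnj z)^3 * u + 8 * z / (1 - z * cnj z)^3 * cnj u"
      unfolding of_real_conf using nz by (simp add: \<phi>_def mult.commute[of "cnj z" z] divide_simps) (simp add: algebra_simps eval_nat_numeral)
    finally show "Re (8 * cnj z / (1 - z * cnj z)^3 * u + 8 * z / (1 - z * cnj z)^3 * cnj u)
      = 2 * conf z * Re (\<phi> z * u)" by (metis Re_complex_of_real)
  qed
  finally show ?thesis .
qed

lemma hyp_metric_eq: "hyp_metric z u v = conf z * (u \<bullet> v)"
  by (simp add: hyp_metric_def conf_def)

text \<open>Multiplication by a complex number is a scaling plus a skew map. This is what makes
  \<open>\<Gamma>(u, v) = \<phi> u v\<close> compatible with a conformal metric, and its complete lift compatible with the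
  lifted metric.\<close>

lemma inner_mult_conformal: "(c * u) \<bullet> v + u \<bullet> (c * v) = 2 * Re c * (u \<bullet> v)" for c u v :: complex
  by (simp add: inner_complex_def algebra_simps)

lemma christoffel_hyp_metric:
  assumes "z \<in> disk"
  shows "christoffel hyp_metric z = (\<lambda>u v. \<phi> z * u * v)"
proof (rule christoffel_eqI)
  have "frechet_derivative (\<lambda>q. hyp_metric q v w) (at z) u = hyp_metric z (\<phi> z * u * v) w + hyp_metric z v (\<phi> z * u * w)" for u v w
  proof -
    have "((\<lambda>q. hyp_metric q v w) has_derivative (\<lambda>u. 2 * conf z * Re (\<phi> z * u) * (v \<bullet> w))) (at z)"
      unfolding hyp_metric_eq by (intro has_derivative_mult_left has_derivative_conf assms)
    then have "frechet_derivative (\<lambda>q. hyp_metric q v w) (at z) = (\<lambda>u. 2 * conf z * Re (\<phi> z * u) * (v \<bullet> w))"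
      by (rule frechet_derivative_at[symmetric])
    then show ?thesis
      using inner_mult_conformal[of "\<phi> z * u" v w]
      by (simp add: hyp_metric_eq flip: distrib_left add_divide_distrib)
  qed
  then show "levi_civita_at hyp_metric z (\<lambda>u v. \<phi> z * u * v)"
    by (auto simp: levi_civita_at_def bilinear_def linear_iff algebra_simps)
  show "bilinear (hyp_metric z)"
    by (auto simp: bilinear_def linear_iff hyp_metric_eq inner_simps algebra_simps add_divide_distrib)
  show "hyp_metric z u v = hyp_metric z v u" for u v
    by (simp add: hyp_metric_eq inner_commute)
  show "w = 0" if "\<And>u. hyp_metric z w u = 0" for w
    using that[of w] conf_pos[OF assms] by (simp add: hyp_metric_eq)
qed

section \<open>The complete lift of the hyperbolic metric\<close>

text \<open>A tangent vector at \<open>(x, v)\<close> is a pair \<open>(a, a')\<close> in the chart; its vertical component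
  is the covariant derivative \<open>a' + \<Gamma>(a, v)\<close>.\<close>

lemma components_eq:
  assumes "fst p \<in> disk"
  shows "components p A = (fst A, snd A + \<phi> (fst p) * fst A * snd p)"
proof -
  have "inv (lift p) = (\<lambda>A. (fst A, snd A + \<phi> (fst p) * fst A * snd p))"
    by (rule inv_equality)
      (auto simp: lift_def horizontal_lift_def vertical_lift_def split_beta christoffel_hyp_metric[OF assms])
  then show ?thesis by (simp add: components_def)
qed

text \<open>In the chart \<open>(x, v)\<close> the last summand is the derivative of \<open>hyp_metric\<close> in direction \<open>v\<close>: the metric
  on the tangent bundle is the formal derivative (the complete lift) of the hyperbolic metric. Its
  Levi-Civita connection can therefore be guessed by differentiating that of the disk.\<close>

lemma tangent_metric_eq:
  assumes "fst p \<in> disk"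
  shows "tangent_metric p A B =
    conf (fst p) * (fst A \<bullet> snd B + snd A \<bullet> fst B + 2 * Re (\<phi> (fst p) * snd p) * (fst A \<bullet> fst B))"
  using inner_mult_conformal[of "\<phi> (fst p) * snd p" "fst A" "fst B"]
  by (simp add: tangent_metric_def components_eq[OF assms] hyp_metric_eq inner_add_left inner_add_right mult_ac
      flip: distrib_left)

lemma tangent_symplectic_eq:
  assumes "fst p \<in> disk"
  shows "tangent_symplectic p A B = conf (fst p) *
    ((\<i> * fst A) \<bullet> (snd B + \<phi> (fst p) * fst B * snd p) - (snd A + \<phi> (fst p) * fst A * snd p) \<bullet> (\<i> * fst B))"
  by (simp add: tangent_symplectic_def components_eq[OF assms] hyp_metric_eq J_def right_diff_distrib)

text \<open>The real differential of \<open>\<phi>\<close> at \<open>z\<close>, applied to \<open>v\<close>.\<close>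

definition d\<phi> :: "complex \<Rightarrow> complex \<Rightarrow> complex" where
  "d\<phi> z v = 2 * ((cnj z)\<^sup>2 * v + cnj v) / (1 - z * cnj z)\<^sup>2"

lemma has_derivative_\<phi>:
  assumes "z \<in> disk"
  shows "(\<phi> has_derivative d\<phi> z) (at z)"
  using has_wirtinger_\<phi>[OF assms]
  by (simp add: has_wirtinger_def d\<phi>_def[abs_def] add_divide_distrib algebra_simps)

text \<open>The antiholomorphic part of the differential of \<open>\<phi>\<close> has a real coefficient, since \<open>\<phi>\<close> is the derivative
  \<open>\<partial>/\<partial>z\<close> of a real function. In the check of metric compatibility this identifies the derivative of
  \<open>\<phi>\<close> along the curve with the derivative of \<open>\<phi>\<close> in the fibre direction.\<close>

lemma Re_d\<phi>_commute: "Re (d\<phi> z v * u) = Re (d\<phi> z u * v)"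
proof -
  define r where "r = 2 / (1 - (cmod z)\<^sup>2)\<^sup>2"
  have "complex_of_real r = 2 / (1 - z * cnj z)\<^sup>2"
    by (simp add: r_def flip: complex_norm_square)
  then have "d\<phi> z w = of_real r * ((cnj z)\<^sup>2 * w + cnj w)" for w
    by (simp add: d\<phi>_def)
  then show ?thesis by (simp add: algebra_simps)
qed

lemma has_derivative_tangent_metric:
  assumes p: "fst p \<in> disk"
  shows "((\<lambda>q. tangent_metric q A B) has_derivative (\<lambda>C.
     2 * conf (fst p) * Re (\<phi> (fst p) * fst C) *
       (fst A \<bullet> snd B + snd A \<bullet> fst B + 2 * Re (\<phi> (fst p) * snd p) * (fst A \<bullet> fst B)) +
     conf (fst p) * (2 * Re (d\<phi> (fst p) (fst C) * snd p + \<phi> (fst p) * snd C) * (fst A \<bullet> fst B)))) (at p)"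
proof (rule has_derivative_transform_within_open)
  show "open (disk \<times> (UNIV :: complex set))" "p \<in> disk \<times> UNIV"
    using p by (auto simp: open_Times mem_Times_iff)
  have fst: "(fst has_derivative fst) (at p)" and snd: "(snd has_derivative snd) (at p)"
    by (auto intro: derivative_intros)
  note c = has_derivative_compose[OF fst has_derivative_conf[OF p]]
    and f = has_derivative_compose[OF fst has_derivative_\<phi>[OF p]]
  show "((\<lambda>q. conf (fst q) * (fst A \<bullet> snd B + snd A \<bullet> fst B + 2 * Re (\<phi> (fst q) * snd q) * (fst A \<bullet> fst B)))
    has_derivative (\<lambda>C.
     2 * conf (fst p) * Re (\<phi> (fst p) * fst C) *
       (fst A \<bullet> snd B + snd A \<bullet> fst B + 2 * Re (\<phi> (fst p) * snd p) * (fst A \<bullet> fst B)) +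
     conf (fst p) * (2 * Re (d\<phi> (fst p) (fst C) * snd p + \<phi> (fst p) * snd C) * (fst A \<bullet> fst B)))) (at p)"
    by (rule has_derivative_eq_rhs[OF has_derivative_mult[OF c has_derivative_add[OF has_derivative_const
            has_derivative_mult_left[OF has_derivative_mult_right[OF has_derivative_Re[OF has_derivative_mult[OF f snd]]]]]]])
      (simp add: fun_eq_iff algebra_simps)
qed (auto simp: tangent_metric_eq)

text \<open>The Christoffel form is the complete lift of \<open>\<Gamma>(a, b) = \<phi> a b\<close>: the second component is the derivative
  of the first one under a variation of the base point in direction \<open>v\<close> and of \<open>a\<close>, \<open>b\<close> in the
  directions \<open>snd A\<close>, \<open>snd B\<close>.\<close>

lemma christoffel_tangent_metric:
  assumes p: "fst p \<in> disk"
  shows "christoffel tangent_metric p = (\<lambda>A B. (\<phi> (fst p) * fst A * fst B,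
    \<phi> (fst p) * (fst A * snd B + snd A * fst B) + d\<phi> (fst p) (snd p) * fst A * fst B))"
    (is "_ = ?\<Gamma>")
proof (rule christoffel_eqI)
  have "frechet_derivative (\<lambda>q. tangent_metric q A B) (at p) C
     = tangent_metric p (?\<Gamma> C A) B + tangent_metric p A (?\<Gamma> C B)" for A B C
  proof -
    let ?f = "\<phi> (fst p)" and ?d = "d\<phi> (fst p)" and ?c = "fst C" and ?a = "fst A" and ?b = "fst B"
    have "(?f * ?c * ?a) \<bullet> snd B + ?a \<bullet> (?f * ?c * snd B) = 2 * Re (?f * ?c) * (?a \<bullet> snd B)"
         "(?f * ?c * snd A) \<bullet> ?b + snd A \<bullet> (?f * ?c * ?b) = 2 * Re (?f * ?c) * (snd A \<bullet> ?b)"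
         "(?f * ?c * ?a) \<bullet> ?b + ?a \<bullet> (?f * ?c * ?b) = 2 * Re (?f * ?c) * (?a \<bullet> ?b)"
         "(?f * snd C * ?a) \<bullet> ?b + ?a \<bullet> (?f * snd C * ?b) = 2 * Re (?f * snd C) * (?a \<bullet> ?b)"
         "(?d (snd p) * ?c * ?a) \<bullet> ?b + ?a \<bullet> (?d (snd p) * ?c * ?b) = 2 * Re (?d (snd p) * ?c) * (?a \<bullet> ?b)"
      by (simp_all only: inner_mult_conformal)
    note conformal = this
    have "tangent_metric p (?\<Gamma> C A) B + tangent_metric p A (?\<Gamma> C B) = conf (fst p) *
       (((?f * ?c * ?a) \<bullet> snd B + ?a \<bullet> (?f * ?c * snd B)) + ((?f * ?c * snd A) \<bullet> ?b + snd A \<bullet> (?f * ?c * ?b))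
        + ((?f * snd C * ?a) \<bullet> ?b + ?a \<bullet> (?f * snd C * ?b))
        + ((?d (snd p) * ?c * ?a) \<bullet> ?b + ?a \<bullet> (?d (snd p) * ?c * ?b))
        + 2 * Re (?f * snd p) * ((?f * ?c * ?a) \<bullet> ?b + ?a \<bullet> (?f * ?c * ?b)))"
      by (simp add: tangent_metric_eq[OF p] inner_add_left inner_add_right distrib_left mult.assoc)
    also have "\<dots> = frechet_derivative (\<lambda>q. tangent_metric q A B) (at p) C"
      unfolding conformal Re_d\<phi>_commute[of "fst p" "snd p" "fst C"] frechet_derivative_at[OF has_derivative_tangent_metric[OF p], symmetric]
        plus_complex.sel
      by (simp only: distrib_left distrib_right mult_ac)
    finally show ?thesis by simp
  qed
  then show "levi_civita_at tangent_metric p ?\<Gamma>"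
    by (auto simp: levi_civita_at_def bilinear_def linear_iff algebra_simps)
  show "bilinear (tangent_metric p)"
    by (auto simp: bilinear_def linear_iff tangent_metric_eq[OF p] inner_add_left inner_add_right algebra_simps)
  show "tangent_metric p A B = tangent_metric p B A" for A B
    by (simp add: tangent_metric_eq[OF p] inner_commute)
  show "A = 0" if A: "\<And>B. tangent_metric p A B = 0" for A
  proof -
    have "fst A = 0"
      using A[of "(0, fst A)"] conf_pos[OF p] by (simp add: tangent_metric_eq[OF p])
    moreover from this have "snd A = 0"
      using A[of "(snd A, 0)"] conf_pos[OF p] by (simp add: tangent_metric_eq[OF p])
    ultimately show ?thesis by (simp add: prod_eq_iff)
  qed
qed

section \<open>Harmonic and Lagrangian sections\<close>

text \<open>Two vectors of equal length at a right angle differ by a factor \<open>\<i>\<close> or \<open>- \<i>\<close>. The vanishing of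
  \<open>e\<^sup>2 + f\<^sup>2\<close> is what the tension field needs: it removes
  all terms of a bilinear form except the one with \<open>u * cnj v\<close>.\<close>

lemma orthonormal_frame_hyp_metric:
  assumes "z \<in> disk" "orthonormal_frame (hyp_metric z) E"
  obtains e f where "E = {e, f}" "e \<noteq> f" "e\<^sup>2 + f\<^sup>2 = 0"
proof -
  from assms(2) have "card E = 2"
    by (simp add: orthonormal_frame_def)
  then obtain e f where E: "E = {e, f}" "e \<noteq> f"
    by (auto simp: card_2_iff)
  have n: "conf z * (e \<bullet> e) = 1" "conf z * (f \<bullet> f) = 1" "conf z * (e \<bullet> f) = 0"
    using assms(2) E by (auto simp: orthonormal_frame_def hyp_metric_eq)
  have "conf z * (e \<bullet> e) = conf z * (f \<bullet> f)"
    by (simp only: n)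
  then have "e \<bullet> e = f \<bullet> f" "e \<bullet> f = 0"
    using conf_pos[OF assms(1)] n(3) by simp_all
  moreover have "f \<noteq> 0"
    using n(2) by auto
  ultimately have "f * cnj f = e * cnj e" "f * cnj e = - (e * cnj f)"
    by (auto simp: inner_complex_def complex_eq_iff mult.commute)
  \<comment> \<open>\<open>f\<^sup>2 (e cnj e) = (f cnj e) (e f) = - e\<^sup>2 (f cnj f)\<close>\<close>
  then have "(f * cnj f) * (e\<^sup>2 + f\<^sup>2) = 0"
    by algebra
  then have "e\<^sup>2 + f\<^sup>2 = 0"
    using \<open>f \<noteq> 0\<close> by simp
  with E that show ?thesis by blast
qed

text \<open>The trace is a definite description that quantifies over all frames, so its uniqueness rests on
  the existence of a frame.\<close>

lemma ex_orthonormal_frame_hyp_metric: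
  assumes "z \<in> disk"
  shows "\<exists>E. orthonormal_frame (hyp_metric z) E"
proof -
  define r where "r = 1 / sqrt (conf z)"
  have r: "r \<noteq> 0" "conf z * (r * r) = 1"
    using conf_pos[OF assms] by (auto simp: r_def)
  have ne: "complex_of_real r \<noteq> \<i> * of_real r"
    using r(1) by (simp add: complex_eq_iff)
  show ?thesis
    by (rule exI[of _ "{of_real r, \<i> * of_real r}"])
      (use r ne ne[symmetric] in \<open>auto simp: orthonormal_frame_def hyp_metric_eq inner_complex_def\<close>)
qed

lemma metric_trace_hyp_metric_eq_0:
  assumes "z \<in> disk" "\<And>e f. e \<noteq> f \<Longrightarrow> e\<^sup>2 + f\<^sup>2 = 0 \<Longrightarrow> T e e + T f f = 0"
  shows "metric_trace (hyp_metric z) T = 0"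
proof -
  have sum: "(\<Sum>e\<in>E. T e e) = 0" if E: "orthonormal_frame (hyp_metric z) E" for E
  proof -
    obtain e f where "E = {e, f}" "e \<noteq> f" "e\<^sup>2 + f\<^sup>2 = 0"
      by (rule orthonormal_frame_hyp_metric[OF assms(1) E])
    then show ?thesis using assms(2)[of e f] by simp
  qed
  then show ?thesis
    unfolding metric_trace_def
    using ex_orthonormal_frame_hyp_metric[OF assms(1)] by (intro the_equality) auto
qed

lemma frechet_derivative_section_of:
  assumes "has_wirtinger V p q z"
  shows "frechet_derivative (section_of V) (at z) = (\<lambda>u. (u, p * u + q * cnj u))"
  using frechet_derivative_at[OF has_derivative_Pair[OF has_derivative_ident assms[unfolded has_wirtinger_def]]]
  by (simp add: section_of_def[abs_def])

text \<open>The Hessian of a section is vertical because the first component of a section is the identity. On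
  the diagonal it is a quadratic form in \<open>u\<close> and \<open>cnj u\<close>, and its coefficients are written so that
  the trace can be read off.\<close>

lemma map_hessian_section_of:
  assumes z: "z \<in> disk"
    and V: "\<And>w. w \<in> disk \<Longrightarrow> has_wirtinger V (p w) (q w) w"
    and p: "has_wirtinger p p1 p2 z" and q: "has_wirtinger q q1 q2 z"
  shows "map_hessian hyp_metric tangent_metric (section_of V) (\<lambda>_. u) (\<lambda>_. u) z =
     (0, (p1 + \<phi> z * p z + d\<phi> z (V z)) * u\<^sup>2 + (q2 - q z * cnj (\<phi> z)) * (cnj u)\<^sup>2
        + (p2 + q1 + 2 * \<phi> z * q z) * (u * cnj u))"
proof -
  have "((\<lambda>w. (u, p w * u + q w * cnj u)) has_derivative
     (\<lambda>h. (0, (p1 * h + p2 * cnj h) * u + (q1 * h + q2 * cnj h) * cnj u))) (at z)"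
    by (intro has_derivative_Pair has_derivative_const has_derivative_add has_derivative_mult_left
        p[unfolded has_wirtinger_def] q[unfolded has_wirtinger_def])
  then have "((\<lambda>w. frechet_derivative (section_of V) (at w) u) has_derivative
     (\<lambda>h. (0, (p1 * h + p2 * cnj h) * u + (q1 * h + q2 * cnj h) * cnj u))) (at z)"
    by (rule has_derivative_transform_within_open[OF _ open_ball z])
      (simp add: frechet_derivative_section_of[OF V])
  note d = frechet_derivative_at[OF this, symmetric]
  have c: "christoffel tangent_metric (section_of V z) = (\<lambda>A B. (\<phi> z * fst A * fst B,
    \<phi> z * (fst A * snd B + snd A * fst B) + d\<phi> z (V z) * fst A * fst B))"
    using christoffel_tangent_metric[of "section_of V z"] z by (simp add: section_of_def)
  have "cov hyp_metric (\<lambda>_. u) z u = \<phi> z * u * u"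
    by (simp add: cov_along_def christoffel_hyp_metric[OF z] frechet_derivative_at[OF has_derivative_ident, symmetric])
  then show ?thesis
    by (simp add: map_hessian_def cov_along_def d c frechet_derivative_section_of[OF V[OF z]])
      (simp add: algebra_simps power2_eq_square)
qed

text \<open>Since \<open>e\<^sup>2 + f\<^sup>2\<close> vanishes for an orthonormal frame, only the mixed coefficient of the Hessian survives
  in the trace. As \<open>p2\<close> and \<open>q1\<close> both are the mixed second derivative of \<open>V\<close>, the equation \<open>eq\<close> says
  that \<open>\<partial>/\<partial>z\<close> annihilates the product of \<open>conf\<close> with \<open>q\<close>, i.e. that this product is
  antiholomorphic.\<close>

lemma tension_section_of_eq_0:
  assumes z: "z \<in> disk"
    and V: "\<And>w. w \<in> disk \<Longrightarrow> has_wirtinger V (p w) (q w) w"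
    and p: "has_wirtinger p p1 p2 z" and q: "has_wirtinger q q1 q2 z"
    and eq: "p2 + q1 + 2 * \<phi> z * q z = 0"
  shows "tension hyp_metric tangent_metric (section_of V) z = 0"
  unfolding tension_def
proof (rule metric_trace_hyp_metric_eq_0[OF z])
  fix e f :: complex assume ef: "e\<^sup>2 + f\<^sup>2 = 0"
  then have "(cnj e)\<^sup>2 + (cnj f)\<^sup>2 = 0"
    by (metis complex_cnj_add complex_cnj_power complex_cnj_zero)
  moreover have "a * e\<^sup>2 + b * (cnj e)\<^sup>2 + (a * f\<^sup>2 + b * (cnj f)\<^sup>2) = a * (e\<^sup>2 + f\<^sup>2) + b * ((cnj e)\<^sup>2 + (cnj f)\<^sup>2)" for a b
    by (simp add: algebra_simps)
  ultimately show "map_hessian hyp_metric tangent_metric (section_of V) (\<lambda>_. e) (\<lambda>_. e) z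
      + map_hessian hyp_metric tangent_metric (section_of V) (\<lambda>_. f) (\<lambda>_. f) z = 0"
    using ef by (simp only: map_hessian_section_of[OF z V p q] eq zero_prod_def add_Pair mult_zero_left mult_zero_right add_0_right)
qed

text \<open>The covariant derivative of \<open>V\<close> in direction \<open>u\<close> is \<open>a u + q (cnj u)\<close> with \<open>a = p + \<phi> V\<close>. The summand
  with \<open>q\<close> is symmetric and anticommutes with \<open>\<i>\<close>, so it drops out of the symplectic form; of \<open>a\<close> only
  the real part remains, which is half the divergence of \<open>V\<close>.\<close>

lemma lagrangian_sectionI:
  assumes V: "\<And>z. z \<in> disk \<Longrightarrow> has_wirtinger V (p z) (q z) z"
    and "\<And>z. z \<in> disk \<Longrightarrow> Re (p z + \<phi> z * V z) = 0"
  shows "lagrangian_section V"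
  unfolding lagrangian_section_def
proof (intro ballI allI)
  fix z u v assume z: "z \<in> disk"
  define a where "a = p z + \<phi> z * V z"
  have "tangent_symplectic (section_of V z) (u, p z * u + q z * cnj u) (v, p z * v + q z * cnj v)
     = conf z * ((\<i> * u) \<bullet> (a * v + q z * cnj v) - (a * u + q z * cnj u) \<bullet> (\<i> * v))"
    using z by (subst tangent_symplectic_eq) (simp_all add: section_of_def a_def algebra_simps)
  also have "(\<i> * u) \<bullet> (a * v + q z * cnj v) - (a * u + q z * cnj u) \<bullet> (\<i> * v) = 2 * Re a * ((\<i> * u) \<bullet> v)"
    by (simp add: inner_complex_def algebra_simps)
  also have "Re a = 0"
    using assms(2)[OF z] by (simp add: a_def)
  finally show "tangent_symplectic (section_of V z) (frechet_derivative (section_of V) (at z) u)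
     (frechet_derivative (section_of V) (at z) v) = 0"
    by (simp add: frechet_derivative_section_of[OF V[OF z]])
qed

section \<open>Smoothness\<close>

lemma Ck_on_cong:
  assumes "open S" "\<And>x. x \<in> S \<Longrightarrow> f x = g x"
  shows "Ck_on k S f \<longleftrightarrow> Ck_on k S g"
  using assms(2)
proof (induction k arbitrary: f g)
  case (Suc k)
  have d: "(f has_derivative D) (at x) \<longleftrightarrow> (g has_derivative D) (at x)" if "x \<in> S" for x D
    using Suc.prems that by (metis assms(1) has_derivative_transform_within_open)
  then have "frechet_derivative f (at x) = frechet_derivative g (at x)" if "x \<in> S" for x
    using that by (simp add: frechet_derivative_def)
  then have "Ck_on k S (\<lambda>x. frechet_derivative f (at x) v) \<longleftrightarrow> Ck_on k S (\<lambda>x. frechet_derivative g (at x) v)" for v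
    by (intro Suc.IH) simp
  with d show ?case
    by (auto simp: differentiable_def)
qed (simp cong: continuous_on_cong)

text \<open>Regularity can be proved from any formula for the derivative on an open set, without reference to
  the chosen \<open>frechet_derivative\<close>.\<close>

lemma Ck_on_SucI:
  assumes "open S" "\<And>x. x \<in> S \<Longrightarrow> (f has_derivative D x) (at x)" "\<And>v. Ck_on k S (\<lambda>x. D x v)"
  shows "Ck_on (Suc k) S f"
proof -
  have "frechet_derivative f (at x) = D x" if "x \<in> S" for x
    using frechet_derivative_at[OF assms(2)[OF that]] by simp
  then have "Ck_on k S (\<lambda>x. frechet_derivative f (at x) v)" for v
    using assms(3)[of v] by (subst Ck_on_cong[OF assms(1)]) auto
  with assms(2) show ?thesis
    by (auto simp: differentiable_def)
qed

lemma Ck_on_Suc_has_derivative: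
  assumes "Ck_on (Suc k) S f" "x \<in> S"
  shows "(f has_derivative frechet_derivative f (at x)) (at x)"
  using assms by (auto simp: frechet_derivative_works)

lemma Ck_on_SucD: "Ck_on (Suc k) S f \<Longrightarrow> Ck_on k S f"
proof (induction k arbitrary: f)
  case 0
  then show ?case
    by (auto intro!: continuous_at_imp_continuous_on differentiable_imp_continuous_within)
next
  case (Suc k)
  then show ?case by (subst Ck_on.simps) auto
qed

lemma Ck_on_add:
  assumes "open S" "Ck_on k S f" "Ck_on k S g"
  shows "Ck_on k S (\<lambda>x. f x + g x)"
  using assms(2-)
proof (induction k arbitrary: f g)
  case (Suc k)
  show ?case
    by (rule Ck_on_SucI[OF assms(1) has_derivative_add[OF
          Suc.prems(1)[THEN Ck_on_Suc_has_derivative] Suc.prems(2)[THEN Ck_on_Suc_has_derivative]]])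
      (use Suc in auto)
qed (auto intro: continuous_intros)

text \<open>By the product rule, the derivative involves the factors themselves, whose regularity of order \<open>k\<close>
  comes from \<open>Ck_on_SucD\<close>.\<close>

lemma Ck_on_mult:
  fixes f g :: "'a::euclidean_space \<Rightarrow> complex"
  assumes "open S" "Ck_on k S f" "Ck_on k S g"
  shows "Ck_on k S (\<lambda>x. f x * g x)"
  using assms(2-)
proof (induction k arbitrary: f g)
  case (Suc k)
  show ?case
    by (rule Ck_on_SucI[OF assms(1) has_derivative_mult[OF
          Suc.prems(1)[THEN Ck_on_Suc_has_derivative] Suc.prems(2)[THEN Ck_on_Suc_has_derivative]]])
      (use Suc.IH Suc.prems Suc.prems[THEN Ck_on_SucD] in \<open>auto intro!: Ck_on_add[OF assms(1)]\<close>)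
qed (auto intro: continuous_intros)

lemma Ck_on_cnj:
  assumes "open S" "Ck_on k S f"
  shows "Ck_on k S (\<lambda>x. cnj (f x))"
  using assms(2)
proof (induction k arbitrary: f)
  case (Suc k)
  show ?case
    by (rule Ck_on_SucI[OF assms(1) has_derivative_cnj[OF Suc.prems[THEN Ck_on_Suc_has_derivative]]])
      (use Suc in auto)
qed (auto intro: continuous_intros)

lemma Ck_on_Pair:
  assumes "open S" "Ck_on k S f" "Ck_on k S g"
  shows "Ck_on k S (\<lambda>x. (f x, g x))"
  using assms(2-)
proof (induction k arbitrary: f g)
  case (Suc k)
  show ?case
    by (rule Ck_on_SucI[OF assms(1) has_derivative_Pair[OF
          Suc.prems(1)[THEN Ck_on_Suc_has_derivative] Suc.prems(2)[THEN Ck_on_Suc_has_derivative]]])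
      (use Suc in auto)
qed (auto intro: continuous_intros)

lemma Ck_on_holomorphic:
  assumes "open S" "f holomorphic_on S"
  shows "Ck_on k S f"
  using assms(2)
proof (induction k arbitrary: f)
  case (Suc k)
  show ?case
  proof (rule Ck_on_SucI[OF assms(1)])
    show "(f has_derivative (\<lambda>v. deriv f x * v)) (at x)" if "x \<in> S" for x
      using holomorphic_derivI[OF Suc.prems assms(1) that] by (simp add: has_field_derivative_def)
    show "Ck_on k S (\<lambda>x. deriv f x * v)" for v
      by (intro Suc.IH holomorphic_intros Suc.prems assms)
  qed
qed (auto intro: holomorphic_on_imp_continuous_on)

section \<open>Cauchy integrals\<close>

definition cauchy :: "nat \<Rightarrow> (complex \<Rightarrow> complex) \<Rightarrow> complex \<Rightarrow> complex" where
  "cauchy k h z = contour_integral (circlepath 0 1) (\<lambda>x. h x / (x - z) ^ k) / (2 * of_real pi * \<i>)"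

lemma integrable_circle:
  assumes "continuous_on (sphere 0 1) h"
  shows "h contour_integrable_on circlepath 0 1"
  using assms by (intro contour_integrable_continuous_circlepath) (simp add: path_image_circlepath)

lemma cauchy_integrable:
  assumes "continuous_on (sphere 0 1) h" "z \<in> disk"
  shows "(\<lambda>x. h x / (x - z) ^ k) contour_integrable_on circlepath 0 1"
  using assms by (intro integrable_circle continuous_intros) auto

lemma cauchy_DERIV:
  assumes "continuous_on (sphere 0 1) h" "z \<in> disk" "k > 0"
  shows "(cauchy k h has_field_derivative of_nat k * cauchy (Suc k) h z) (at z)"
proof -
  have "((\<lambda>z. contour_integral (circlepath 0 1) (\<lambda>x. h x / (x - z) ^ k)) has_field_derivative
      of_nat k * contour_integral (circlepath 0 1) (\<lambda>x. h x / (x - z) ^ Suc k)) (at z)"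
    using assms
    by (intro Cauchy_next_derivative_circlepath(2)[where r = 1 and z = 0]
        has_contour_integral_integral cauchy_integrable) (auto simp: path_image_circlepath)
  from DERIV_cdivide[OF this, of "2 * of_real pi * \<i>"] show ?thesis
    by (simp add: cauchy_def[abs_def])
qed

text \<open>Write \<open>x = (x - z) + z\<close> in the numerator. Together with \<open>cauchy_DERIV\<close> this expresses \<open>z\<close> times the
  derivative of \<open>cauchy k h\<close> by Cauchy integrals alone.\<close>

lemma cauchy_recurrence:
  assumes h: "continuous_on (sphere 0 1) h" and z: "z \<in> disk"
  shows "cauchy (Suc k) (\<lambda>x. x * h x) z = cauchy k h z + z * cauchy (Suc k) h z"
proof -
  have "contour_integral (circlepath 0 1) (\<lambda>x. x * h x / (x - z) ^ Suc k) =
     contour_integral (circlepath 0 1) (\<lambda>x. h x / (x - z) ^ k + z * (h x / (x - z) ^ Suc k))"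
  proof (rule contour_integral_eq)
    fix x assume "x \<in> path_image (circlepath 0 1)"
    then have "x - z \<noteq> 0" using z by (auto simp: path_image_circlepath)
    then show "x * h x / (x - z) ^ Suc k = h x / (x - z) ^ k + z * (h x / (x - z) ^ Suc k)"
      by (simp add: field_simps)
  qed
  also have "\<dots> = contour_integral (circlepath 0 1) (\<lambda>x. h x / (x - z) ^ k)
     + z * contour_integral (circlepath 0 1) (\<lambda>x. h x / (x - z) ^ Suc k)"
    by (subst contour_integral_add)
      (intro cauchy_integrable contour_integrable_lmul h z contour_integral_lmul arg_cong2[of _ _ _ _ "(+)"] refl)+
  finally show ?thesis
    unfolding cauchy_def by (simp add: add_divide_distrib)
qed

lemma cauchy_holomorphic:
  assumes "continuous_on (sphere 0 1) h" "k > 0"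
  shows "cauchy k h holomorphic_on disk"
  unfolding holomorphic_on_open[OF open_ball] using cauchy_DERIV[OF assms(1) _ assms(2)] by blast

text \<open>On the unit circle \<open>dx = \<i> x d\<theta>\<close>, so conjugation turns \<open>dx\<close> into \<open>- dx / x\<^sup>2\<close>.\<close>

lemma contour_integral_circlepath_cnj:
  "cnj (contour_integral (circlepath 0 1) h) = contour_integral (circlepath 0 1) (\<lambda>x. - cnj (h x) / x\<^sup>2)"
proof -
  let ?g = "circlepath 0 1"
  have "cnj (contour_integral ?g h) = integral {0..1} (\<lambda>t. cnj (h (?g t) * vector_derivative ?g (at t)))"
    by (simp only: contour_integral_integral integral_cnj)
  also have "\<dots> = integral {0..1} (\<lambda>t. - cnj (h (?g t)) / (?g t)\<^sup>2 * vector_derivative ?g (at t))"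
  proof (intro arg_cong2[of _ _ _ _ integral] refl ext)
    fix t
    define e where "e = ?g t"
    have e: "e = exp (2 * of_real pi * \<i> * of_real t)"
      by (simp add: e_def circlepath)
    have "cnj e = 1 / e"
      by (simp add: e exp_cnj exp_minus divide_inverse)
    moreover have "vector_derivative ?g (at t) = 2 * of_real pi * \<i> * e"
      by (simp add: e vector_derivative_circlepath)
    moreover have "e \<noteq> 0" by (simp add: e)
    ultimately show "cnj (h (?g t) * vector_derivative ?g (at t)) =
        - cnj (h (?g t)) / (?g t)\<^sup>2 * vector_derivative ?g (at t)"
      unfolding e_def[symmetric] by (simp add: power2_eq_square)
  qed
  finally show ?thesis by (simp only: contour_integral_integral)
qed

lemma cnj_on_circle: "x \<in> sphere 0 1 \<Longrightarrow> cnj x = 1 / x"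
  by (metis complex_div_cnj dist_0_norm div_by_1 mem_sphere mult_1 of_real_1 power_one)

text \<open>Tangency says that \<open>X x = \<i> x r\<close> with a real number \<open>r\<close>, and \<open>cnj x = 1 / x\<close>.\<close>

lemma cnj_circle_field:
  assumes "continuous_circle_field X" "x \<in> sphere 0 1"
  shows "cnj (X x) = - X x / x\<^sup>2"
proof -
  have "X x * cnj x + cnj (X x) * x = 0"
    using assms unfolding continuous_circle_field_def
    by (auto simp: inner_complex_def complex_eq_iff)
  then have "cnj (X x) * x = - X x / x"
    by (simp add: cnj_on_circle[OF assms(2)] eq_neg_iff_add_eq_0 add.commute)
  moreover have "x \<noteq> 0" using assms(2) by auto
  ultimately have "cnj (X x) = (- X x / x) / x"
    by (metis nonzero_mult_div_cancel_right)
  then show ?thesis by (simp add: power2_eq_square)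
qed

section \<open>The infinitesimal Douady-Earle extension\<close>

text \<open>The Cauchy integral for the point \<open>1 / cnj z\<close>, the reflection of \<open>z\<close> in the circle.\<close>

definition reflected_cauchy :: "nat \<Rightarrow> (complex \<Rightarrow> complex) \<Rightarrow> complex \<Rightarrow> complex" where
  "reflected_cauchy k X z = contour_integral (circlepath 0 1) (\<lambda>x. X x / (1 - cnj z * x) ^ k) / (2 * of_real pi * \<i>)"

lemma has_wirtinger_transform_within_open:
  assumes "has_wirtinger f a b z" "open S" "z \<in> S" "\<And>w. w \<in> S \<Longrightarrow> f w = g w"
  shows "has_wirtinger g a b z"
  using assms unfolding has_wirtinger_def by (rule has_derivative_transform_within_open)

lemma one_minus_cnj_mult_ne_0:
  assumes "z \<in> disk" "x \<in> sphere 0 1"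
  shows "1 - cnj z * x \<noteq> 0"
proof
  assume "1 - cnj z * x = 0"
  then have "cmod (cnj z * x) = 1" by simp
  with assms show False by (simp add: norm_mult)
qed

lemma cnj_diff_on_circle:
  assumes "x \<in> sphere 0 1"
  shows "cnj (x - z) = (1 - cnj z * x) / x"
proof -
  have "x \<noteq> 0" using assms by auto
  then show ?thesis by (simp add: cnj_on_circle[OF assms] diff_divide_distrib)
qed

text \<open>On the circle \<open>1 - cnj z * x\<close> is \<open>x * cnj (x - z)\<close>, so conjugation turns a reflected integral into an
  ordinary one. The powers of \<open>x\<close> collect the factor \<open>x\<^sup>k\<close> from here and a factor \<open>1 / x\<^sup>2\<close> each from \<open>dx\<close> and
  from \<open>cnj (X x) = - X x / x\<^sup>2\<close>. Tangency is what
  leaves \<open>X\<close> itself in the density instead of its conjugate.\<close>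

lemma reflected_cauchy_eq_cnj_cauchy:
  assumes X: "continuous_circle_field X" and z: "z \<in> disk"
  shows "reflected_cauchy k X z = - cnj (cauchy k (\<lambda>x. X x * x ^ k / x ^ 4) z)"
proof -
  have "cnj (contour_integral (circlepath 0 1) (\<lambda>x. X x * x ^ k / x ^ 4 / (x - z) ^ k))
    = contour_integral (circlepath 0 1) (\<lambda>x. X x / (1 - cnj z * x) ^ k)"
    unfolding contour_integral_circlepath_cnj
  proof (rule contour_integral_eq)
    fix x assume "x \<in> path_image (circlepath 0 1)"
    then have x: "x \<in> sphere 0 1" by (simp add: path_image_circlepath)
    then have "x \<noteq> 0" by auto
    then show "- cnj (X x * x ^ k / x ^ 4 / (x - z) ^ k) / x\<^sup>2 = X x / (1 - cnj z * x) ^ k"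
      unfolding complex_cnj_divide complex_cnj_mult complex_cnj_power
        cnj_diff_on_circle[OF x] cnj_circle_field[OF X x] cnj_on_circle[OF x]
      using one_minus_cnj_mult_ne_0[OF z x]
      by (simp add: field_simps eval_nat_numeral)
  qed
  then show ?thesis by (simp add: cauchy_def reflected_cauchy_def)
qed

lemma continuous_on_field_powers:
  assumes "continuous_circle_field X"
  shows "continuous_on (sphere 0 1) (\<lambda>x. X x * x ^ k / x ^ 4)"
  using assms unfolding continuous_circle_field_def by (auto intro!: continuous_intros)

text \<open>The derivative \<open>D\<close> enters the derivatives of \<open>L0 X\<close> only through \<open>cnj z * D\<close>, and this product is
  a difference of two reflected Cauchy integrals with the same density. Hence those derivatives
  reduce to algebraic expressions in reflected Cauchy integrals.\<close>

lemma has_wirtinger_reflected_cauchy: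
  assumes X: "continuous_circle_field X" and z: "z \<in> disk" and "k > 0"
  obtains D where "has_wirtinger (reflected_cauchy k X) 0 D z"
    and "cnj z * D = of_nat k * (reflected_cauchy (Suc k) X z - reflected_cauchy k X z)"
proof
  let ?h = "\<lambda>x. X x * x ^ k / x ^ 4"
  let ?D = "- cnj (of_nat k * cauchy (Suc k) ?h z)"
  have "has_wirtinger (\<lambda>w. 0 - cnj (cauchy k ?h w)) 0 ?D z"
    using has_wirtinger_diff[OF has_wirtinger_const[of 0] has_wirtinger_cnj[OF has_wirtinger_DERIV[OF
          cauchy_DERIV[OF continuous_on_field_powers[OF X, of k] z \<open>k > 0\<close>]]]]
    by simp
  then show "has_wirtinger (reflected_cauchy k X) 0 ?D z"
    by (rule has_wirtinger_transform_within_open[OF _ open_ball z]) (simp add: reflected_cauchy_eq_cnj_cauchy[OF X])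
  have "cauchy (Suc k) (\<lambda>x. X x * x ^ Suc k / x ^ 4) z = cauchy k ?h z + z * cauchy (Suc k) ?h z"
    using cauchy_recurrence[OF continuous_on_field_powers[OF X] z, of k k] by (simp add: mult_ac)
  then show "cnj z * ?D = of_nat k * (reflected_cauchy (Suc k) X z - reflected_cauchy k X z)"
    unfolding reflected_cauchy_eq_cnj_cauchy[OF X z] by (simp add: algebra_simps)
qed

lemma reflected_cauchy_integrable:
  assumes "continuous_circle_field X" "z \<in> disk"
  shows "(\<lambda>x. X x / (1 - cnj z * x) ^ k) contour_integrable_on circlepath 0 1"
  using assms one_minus_cnj_mult_ne_0[OF assms(2)]
  by (intro integrable_circle continuous_intros) (auto simp: continuous_circle_field_def)

text \<open>The kernels that occur are rational functions of \<open>x\<close> with poles at \<open>z\<close> and at \<open>1 / cnj z\<close>, so their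
  partial fractions reduce every integral to the two families of Cauchy integrals.\<close>

lemma contour_integral_partial_fractions:
  assumes X: "continuous_circle_field X" and z: "z \<in> disk"
    and eq: "\<And>x. x \<in> sphere 0 1 \<Longrightarrow> F x = 
      (\<Sum>k<n. a k * (X x / (x - z) ^ k)) + (\<Sum>k<m. b k * (X x / (1 - cnj z * x) ^ k))"
  shows "contour_integral (circlepath 0 1) F / (2 * of_real pi * \<i>) =
    (\<Sum>k<n. a k * cauchy k X z) + (\<Sum>k<m. b k * reflected_cauchy k X z)"
proof -
  let ?g = "circlepath 0 1"
  have cX: "continuous_on (sphere 0 1) X" using X by (simp add: continuous_circle_field_def)
  have "contour_integral ?g F = contour_integral ?g (\<lambda>x. 
      (\<Sum>k<n. a k * (X x / (x - z) ^ k)) + (\<Sum>k<m. b k * (X x / (1 - cnj z * x) ^ k)))"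
    by (rule contour_integral_eq) (simp add: eq path_image_circlepath)
  also have "\<dots> = (\<Sum>k<n. a k * contour_integral ?g (\<lambda>x. X x / (x - z) ^ k))
     + (\<Sum>k<m. b k * contour_integral ?g (\<lambda>x. X x / (1 - cnj z * x) ^ k))"
    using cauchy_integrable[OF cX z] reflected_cauchy_integrable[OF X z]
    by (simp add: contour_integral_add contour_integrable_sum contour_integrable_lmul contour_integral_sum contour_integral_lmul
        del: times_divide_eq_right)
  finally show ?thesis
    by (simp add: cauchy_def reflected_cauchy_def add_divide_distrib sum_divide_distrib)
qed

text \<open>Iterate \<open>s / (w * y) = c / w + 1 / y\<close>. It is used for \<open>y = x - z\<close>, \<open>w = 1 - cnj z * x\<close> and \<open>c = cnj z\<close>, where
  \<open>s = 1 - z * cnj z\<close>.\<close>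

lemma L0_kernel_partial_fractions:
  fixes y w c s a :: "'a::field"
  assumes "y \<noteq> 0" "w \<noteq> 0" "s = c * y + w"
  shows "s ^ 3 * (a / (w ^ 3 * y)) = a / y + c * (a / w) + c * s * (a / w\<^sup>2) + c * s\<^sup>2 * (a / w ^ 3)"
proof -
  have "s ^ 3 * a = a * w ^ 3 + c * a * w\<^sup>2 * y + c * s * a * w * y + c * s\<^sup>2 * a * y"
    unfolding assms(3) by algebra
  then have "s ^ 3 * a / (w ^ 3 * y) = (a * w ^ 3 + c * a * w\<^sup>2 * y + c * s * a * w * y + c * s\<^sup>2 * a * y) / (w ^ 3 * y)"
    by simp
  also have "\<dots> = a / y + c * (a / w) + c * s * (a / w\<^sup>2) + c * s\<^sup>2 * (a / w ^ 3)"
    using assms(1,2) by (simp add: add_divide_distrib eval_nat_numeral)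
  finally show ?thesis by simp
qed

text \<open>The factor \<open>(1 - |z|\<^sup>2)\<^sup>3\<close> cancels the denominators that the partial fraction decomposition of the
  kernel produces. What is left is a polynomial in \<open>z\<close>, \<open>cnj z\<close>, a holomorphic function and three
  antiholomorphic ones, so that smoothness is evident.\<close>

lemma L0_eq:
  assumes X: "continuous_circle_field X" and z: "z \<in> disk"
  shows "L0 X z = cauchy 1 X z + cnj z * reflected_cauchy 1 X z + cnj z * (1 - z * cnj z) * reflected_cauchy 2 X z
    + cnj z * (1 - z * cnj z)\<^sup>2 * reflected_cauchy 3 X z"
proof -
  define s where "s = 1 - z * cnj z"
  have s: "of_real ((1 - (cmod z)\<^sup>2) ^ 3) = s ^ 3"
    by (simp add: s_def flip: complex_norm_square)
  let ?F = "\<lambda>x. X x / ((1 - cnj z * x) ^ 3 * (x - z))"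
  let ?a = "\<lambda>k::nat. if k = 1 then 1 else 0"
  let ?b = "\<lambda>k::nat. if k = 0 then 0 else cnj z * s ^ (k - 1)"
  have eq: "s ^ 3 * ?F x = (\<Sum>k<2. ?a k * (X x / (x - z) ^ k)) + (\<Sum>k<4. ?b k * (X x / (1 - cnj z * x) ^ k))"
    if x: "x \<in> sphere 0 1" for x
  proof -
    define y w where "y = x - z" and "w = 1 - cnj z * x"
    have nz: "y \<noteq> 0" "w \<noteq> 0"
      using z x one_minus_cnj_mult_ne_0[OF z x] by (auto simp: y_def w_def)
    have "s = cnj z * y + w"
      by (simp add: s_def y_def w_def algebra_simps)
    then have "s ^ 3 * (X x / (w ^ 3 * y)) = X x / y + cnj z * (X x / w) + cnj z * s * (X x / w\<^sup>2) + cnj z * s\<^sup>2 * (X x / w ^ 3)"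
      by (rule L0_kernel_partial_fractions[OF nz])
    then show ?thesis
      by (simp add: y_def w_def eval_nat_numeral)
  qed
  have "L0 X z = contour_integral (circlepath 0 1) (\<lambda>x. s ^ 3 * ?F x) / (2 * of_real pi * \<i>)"
  proof -
    have "?F contour_integrable_on circlepath 0 1"
      using X z one_minus_cnj_mult_ne_0[OF z]
      by (intro integrable_circle continuous_intros) (auto simp: continuous_circle_field_def)
    then show ?thesis
      unfolding L0_def s by (simp only: contour_integral_lmul) (simp add: mult_ac)
  qed
  also have "\<dots> = (\<Sum>k<2. ?a k * cauchy k X z) + (\<Sum>k<4. ?b k * reflected_cauchy k X z)"
    by (rule contour_integral_partial_fractions[OF X z eq])
  finally show ?thesis
    by (simp add: s_def eval_nat_numeral)
qed

definition L0_dz :: "(complex \<Rightarrow> complex) \<Rightarrow> complex \<Rightarrow> complex" where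
  "L0_dz X z = cauchy 2 X z - (cnj z)\<^sup>2 * reflected_cauchy 2 X z - 2 * ((cnj z)\<^sup>2 * (1 - z * cnj z)) * reflected_cauchy 3 X z"

text \<open>The quotient by \<open>(1 - z * cnj z)\<^sup>2\<close> is antiholomorphic, which is harmonicity of \<open>L0 X\<close>.\<close>

definition L0_dzbar :: "(complex \<Rightarrow> complex) \<Rightarrow> complex \<Rightarrow> complex" where
  "L0_dzbar X z = 3 * (1 - z * cnj z)\<^sup>2 * reflected_cauchy 4 X z"

lemma has_wirtinger_reflected_cauchy_1_4:
  assumes X: "continuous_circle_field X" and z: "z \<in> disk"
  obtains D1 D2 D3 D4 where
    "has_wirtinger (reflected_cauchy 1 X) 0 D1 z" "cnj z * D1 = reflected_cauchy 2 X z - reflected_cauchy 1 X z"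
    "has_wirtinger (reflected_cauchy 2 X) 0 D2 z" "cnj z * D2 = 2 * (reflected_cauchy 3 X z - reflected_cauchy 2 X z)"
    "has_wirtinger (reflected_cauchy 3 X) 0 D3 z" "cnj z * D3 = 3 * (reflected_cauchy 4 X z - reflected_cauchy 3 X z)"
    "has_wirtinger (reflected_cauchy 4 X) 0 D4 z"
proof -
  have "\<exists>D. has_wirtinger (reflected_cauchy k X) 0 D z \<and> cnj z * D = of_nat k * (reflected_cauchy (Suc k) X z - reflected_cauchy k X z)"
    if "k > 0" for k
    using has_wirtinger_reflected_cauchy[OF X z that] by metis
  from this[of 1] this[of 2] this[of 3] this[of 4] show ?thesis
    using that by (auto simp: eval_nat_numeral)
qed

text \<open>In the derivative with respect to \<open>cnj z\<close> the reflected integrals of orders 1, 2 and 3 cancel.\<close>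

lemma has_wirtinger_L0:
  assumes X: "continuous_circle_field X" and z: "z \<in> disk"
  shows "has_wirtinger (L0 X) (L0_dz X z) (L0_dzbar X z) z"
proof -
  have cX: "continuous_on (sphere 0 1) X" using X by (simp add: continuous_circle_field_def)
  obtain D1 D2 D3 where D:
    "has_wirtinger (reflected_cauchy 1 X) 0 D1 z" "cnj z * D1 = reflected_cauchy 2 X z - reflected_cauchy 1 X z"
    "has_wirtinger (reflected_cauchy 2 X) 0 D2 z" "cnj z * D2 = 2 * (reflected_cauchy 3 X z - reflected_cauchy 2 X z)"
    "has_wirtinger (reflected_cauchy 3 X) 0 D3 z" "cnj z * D3 = 3 * (reflected_cauchy 4 X z - reflected_cauchy 3 X z)"
    by (rule has_wirtinger_reflected_cauchy_1_4[OF X z])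
  note c = has_wirtinger_cnj[OF has_wirtinger_ident[of z]]
  note s = has_wirtinger_one_minus_mult_cnj[of z]
  have A: "has_wirtinger (cauchy 1 X) (cauchy 2 X z) 0 z"
    using has_wirtinger_DERIV[OF cauchy_DERIV[OF cX z, of 1]] by (simp add: numeral_2_eq_2)
  have "has_wirtinger (\<lambda>z. cauchy 1 X z + cnj z * reflected_cauchy 1 X z + cnj z * (1 - z * cnj z) * reflected_cauchy 2 X z
    + cnj z * ((1 - z * cnj z) * (1 - z * cnj z)) * reflected_cauchy 3 X z) (L0_dz X z) (L0_dzbar X z) z"
  proof (rule has_wirtinger_eq[OF has_wirtinger_add[OF has_wirtinger_add[OF has_wirtinger_add[OF A
        has_wirtinger_mult[OF c D(1)]] has_wirtinger_mult[OF has_wirtinger_mult[OF c s] D(3)]]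
        has_wirtinger_mult[OF has_wirtinger_mult[OF c has_wirtinger_mult[OF s s]] D(5)]]], goal_cases)
    case 1
    show ?case by (simp add: L0_dz_def) algebra
  next
    case 2
    show ?case using D(2,4,6) unfolding L0_dzbar_def complex_cnj_zero complex_cnj_one by algebra
  qed
  then show ?thesis
    by (rule has_wirtinger_transform_within_open[OF _ open_ball z]) (simp add: L0_eq[OF X] power2_eq_square)
qed

text \<open>The mixed second derivative, here and in \<open>has_wirtinger_L0_dzbar\<close>, is all that the tension field
  depends on; the pure second derivatives are left unspecified.\<close>

lemma has_wirtinger_L0_dz:
  assumes X: "continuous_circle_field X" and z: "z \<in> disk"
  obtains a where "has_wirtinger (L0_dz X) a (- 6 * cnj z * (1 - z * cnj z) * reflected_cauchy 4 X z) z"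
proof -
  have cX: "continuous_on (sphere 0 1) X" using X by (simp add: continuous_circle_field_def)
  obtain D2 D3 where D:
    "has_wirtinger (reflected_cauchy 2 X) 0 D2 z" "cnj z * D2 = 2 * (reflected_cauchy 3 X z - reflected_cauchy 2 X z)"
    "has_wirtinger (reflected_cauchy 3 X) 0 D3 z" "cnj z * D3 = 3 * (reflected_cauchy 4 X z - reflected_cauchy 3 X z)"
    by (rule has_wirtinger_reflected_cauchy_1_4[OF X z])
  note c = has_wirtinger_cnj[OF has_wirtinger_ident[of z]]
  note c2 = has_wirtinger_mult[OF c c, folded power2_eq_square]
  note s = has_wirtinger_one_minus_mult_cnj[of z]
  have A: "has_wirtinger (cauchy 2 X) (2 * cauchy 3 X z) 0 z"
    using has_wirtinger_DERIV[OF cauchy_DERIV[OF cX z, of 2]] by (simp add: eval_nat_numeral)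
  show ?thesis
    unfolding L0_dz_def[abs_def]
    by (rule that[unfolded L0_dz_def[abs_def], OF has_wirtinger_eq[OF has_wirtinger_diff[OF has_wirtinger_diff[OF A
          has_wirtinger_mult[OF c2 D(1)]] has_wirtinger_mult[OF has_wirtinger_mult[OF has_wirtinger_const has_wirtinger_mult[OF c2 s]] D(3)]] refl]])
      (use D(2,4) in \<open>unfold complex_cnj_zero complex_cnj_one, algebra\<close>)
qed

lemma has_wirtinger_L0_dzbar:
  assumes X: "continuous_circle_field X" and z: "z \<in> disk"
  obtains b where "has_wirtinger (L0_dzbar X) (- 6 * cnj z * (1 - z * cnj z) * reflected_cauchy 4 X z) b z"
proof -
  obtain D4 where D: "has_wirtinger (reflected_cauchy 4 X) 0 D4 z"
    by (rule has_wirtinger_reflected_cauchy_1_4[OF X z])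
  note s = has_wirtinger_one_minus_mult_cnj[of z]
  show ?thesis
    by (rule that[unfolded L0_dzbar_def[abs_def] power2_eq_square, OF has_wirtinger_eq[OF
          has_wirtinger_mult[OF has_wirtinger_mult[OF has_wirtinger_const has_wirtinger_mult[OF s s]] D] _ refl]])
      simp
qed

lemma smooth_on_L0:
  assumes X: "continuous_circle_field X"
  shows "smooth_on disk (L0 X)" "smooth_on disk (section_of (L0 X))"
proof -
  note op = open_ball[of "0::complex" 1]
  have hol: "Ck_on k disk f" if "f holomorphic_on disk" for k and f :: "complex \<Rightarrow> complex"
    using that by (rule Ck_on_holomorphic[OF op])
  have id: "Ck_on k disk (\<lambda>z. z)" and cnj: "Ck_on k disk cnj" for k
    using hol[of "\<lambda>z. z" k] Ck_on_cnj[OF op, of k "\<lambda>z. z"] by auto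
  have A: "Ck_on k disk (cauchy 1 X)" for k
    using X by (auto intro!: hol cauchy_holomorphic simp: continuous_circle_field_def)
  have M: "Ck_on k disk (reflected_cauchy j X)" if "j > 0" for j k
  proof -
    let ?h = "\<lambda>x. X x * x ^ j / x ^ 4"
    have "Ck_on k disk (\<lambda>z. cnj (- cauchy j ?h z))"
      by (intro Ck_on_cnj[OF op] hol holomorphic_on_minus cauchy_holomorphic continuous_on_field_powers[OF X] that)
    then show ?thesis
      by (subst Ck_on_cong[OF op, where g = "\<lambda>z. cnj (- cauchy j ?h z)"]) (simp_all add: reflected_cauchy_eq_cnj_cauchy[OF X])
  qed
  \<comment> \<open>Subtraction is written as addition of a multiple, so that closure under sums and products suffices.\<close>
  have s: "Ck_on k disk (\<lambda>z. 1 + (- 1) * z * cnj z)" for k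
    by (intro Ck_on_add[OF op] Ck_on_mult[OF op] hol[of "\<lambda>_. _"] id cnj holomorphic_on_const)
  have V: "Ck_on k disk (L0 X)" for k
  proof (subst Ck_on_cong[OF op])
    show "L0 X z = cauchy 1 X z + cnj z * reflected_cauchy 1 X z + cnj z * (1 + (- 1) * z * cnj z) * reflected_cauchy 2 X z
      + cnj z * ((1 + (- 1) * z * cnj z) * (1 + (- 1) * z * cnj z)) * reflected_cauchy 3 X z" if "z \<in> disk" for z
      unfolding L0_eq[OF X that] power2_eq_square by simp
    show "Ck_on k disk (\<lambda>z. cauchy 1 X z + cnj z * reflected_cauchy 1 X z + cnj z * (1 + (- 1) * z * cnj z) * reflected_cauchy 2 X z
      + cnj z * ((1 + (- 1) * z * cnj z) * (1 + (- 1) * z * cnj z)) * reflected_cauchy 3 X z)"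
      by (intro Ck_on_add[OF op] Ck_on_mult[OF op] A M cnj s) auto
  qed
  then show "smooth_on disk (L0 X)" by (simp add: smooth_on_def)
  show "smooth_on disk (section_of (L0 X))"
    unfolding smooth_on_def section_of_def[abs_def] by (intro allI Ck_on_Pair[OF op] id V)
qed

text \<open>The covariant \<open>\<partial>/\<partial>z\<close>-derivative of \<open>L0 X\<close> has the kernel \<open>((1 - |z|\<^sup>2) / (w y))\<^sup>2\<close> with \<open>y = x - z\<close> and
  \<open>w = 1 - cnj z * x\<close>. On the circle \<open>w y = x |y|\<^sup>2\<close>, \<open>X x = \<i> x r\<close> with \<open>r\<close> real, and
  \<open>dx = \<i> x d\<theta>\<close>, so the integral is real, and it gets divided by \<open>2 \<pi> \<i>\<close>.\<close>

lemma Re_L0_dz_eq_0: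
  assumes X: "continuous_circle_field X" and z: "z \<in> disk"
  shows "Re (L0_dz X z + \<phi> z * L0 X z) = 0"
proof -
  define s where "s = 1 - z * cnj z"
  have s: "s \<noteq> 0" "cnj s = s"
    using one_minus_mult_cnj_ne_0[OF z] by (simp_all add: s_def mult.commute)
  let ?c = "cnj z" and ?I = "contour_integral (circlepath 0 1)"
  let ?F = "\<lambda>x. X x / ((1 - ?c * x)\<^sup>2 * (x - z)\<^sup>2)"
  let ?a = "\<lambda>k::nat. if k = 0 then 0 else if k = 1 then 2 * ?c / s else 1"
  let ?b = "\<lambda>k::nat. if k = 0 then 0 else if k = 1 then 2 * ?c\<^sup>2 / s else ?c\<^sup>2"
  have eq: "s\<^sup>2 * ?F x = (\<Sum>k<3. ?a k * (X x / (x - z) ^ k)) + (\<Sum>k<3. ?b k * (X x / (1 - ?c * x) ^ k))"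
    if x: "x \<in> sphere 0 1" for x
  proof -
    define y w where "y = x - z" and "w = 1 - ?c * x"
    have nz: "y \<noteq> 0" "w \<noteq> 0"
      using z x one_minus_cnj_mult_ne_0[OF z x] by (auto simp: y_def w_def)
    have "s = ?c * y + w"
      by (simp add: s_def y_def w_def algebra_simps)
    then have 1: "s / (w * y) = 1 / y + ?c / w"
      using nz by (simp add: field_simps)
    have 2: "1 / (w * y) = (1 / y + ?c / w) / s"
      using s(1) by (simp flip: 1)
    have "s\<^sup>2 * (X x / (w\<^sup>2 * y\<^sup>2)) = X x * (s / (w * y))\<^sup>2"
      by (simp add: power_divide power_mult_distrib)
    also have "\<dots> = X x * (1 / y\<^sup>2 + 2 * ?c * (1 / (w * y)) + ?c\<^sup>2 / w\<^sup>2)"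
      unfolding 1 by (simp add: power2_sum power_divide algebra_simps)
    also have "\<dots> = X x / y\<^sup>2 + 2 * ?c / s * (X x / y) + (2 * ?c\<^sup>2 / s * (X x / w) + ?c\<^sup>2 * (X x / w\<^sup>2))"
      unfolding 2 by (simp add: distrib_left add_divide_distrib power2_eq_square mult_ac)
    finally show ?thesis
      by (simp add: y_def w_def eval_nat_numeral)
  qed
  have int: "?F contour_integrable_on circlepath 0 1"
    using X z one_minus_cnj_mult_ne_0[OF z]
    by (intro integrable_circle continuous_intros) (auto simp: continuous_circle_field_def)
  have "cnj (?I ?F) = ?I ?F"
    unfolding contour_integral_circlepath_cnj
  proof (rule contour_integral_eq)
    fix x assume "x \<in> path_image (circlepath 0 1)"
    then have x: "x \<in> sphere 0 1" by (simp add: path_image_circlepath)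
    then have nz: "x \<noteq> 0" "x - z \<noteq> 0" using z by auto
    have w: "cnj (1 - ?c * x) = (x - z) / x"
      using nz by (simp add: cnj_on_circle[OF x] diff_divide_distrib)
    show "- cnj (?F x) / x\<^sup>2 = ?F x"
      unfolding complex_cnj_divide complex_cnj_mult[of "(1 - ?c * x)\<^sup>2"] complex_cnj_power w
        cnj_diff_on_circle[OF x] cnj_circle_field[OF X x]
      using one_minus_cnj_mult_ne_0[OF z x] nz by (simp add: field_simps)
  qed
  then have "cnj (s\<^sup>2 * ?I ?F / (2 * of_real pi * \<i>)) = - (s\<^sup>2 * ?I ?F / (2 * of_real pi * \<i>))"
    by (simp add: s(2))
  moreover have "s\<^sup>2 * ?I ?F / (2 * of_real pi * \<i>) = L0_dz X z + \<phi> z * L0 X z"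
  proof -
    have "s\<^sup>2 * ?I ?F / (2 * of_real pi * \<i>) = ?I (\<lambda>x. s\<^sup>2 * ?F x) / (2 * of_real pi * \<i>)"
      by (simp only: contour_integral_lmul[OF int])
    also have "\<dots> = (\<Sum>k<3. ?a k * cauchy k X z) + (\<Sum>k<3. ?b k * reflected_cauchy k X z)"
      by (rule contour_integral_partial_fractions[OF X z eq])
    also have "\<dots> = 2 * ?c / s * cauchy 1 X z + cauchy 2 X z + (2 * ?c\<^sup>2 / s * reflected_cauchy 1 X z + ?c\<^sup>2 * reflected_cauchy 2 X z)"
      by (simp add: eval_nat_numeral)
    also have "\<dots> = L0_dz X z + \<phi> z * L0 X z"
      unfolding L0_eq[OF X z] L0_dz_def \<phi>_def s_def[symmetric]
      using s(1) by (simp add: field_simps power2_eq_square)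
    finally show ?thesis .
  qed
  ultimately show ?thesis
    by (simp add: complex_eq_iff)
qed

theorem proposition5p4:
  fixes X :: "complex \<Rightarrow> complex"
  assumes "continuous_circle_field X"
  shows "harmonic_lagrangian (L0 X)"
proof -
  have "tension hyp_metric tangent_metric (section_of (L0 X)) z = 0" if z: "z \<in> disk" for z
  proof -
    obtain a b where ab:
      "has_wirtinger (L0_dz X) a (- 6 * cnj z * (1 - z * cnj z) * reflected_cauchy 4 X z) z"
      "has_wirtinger (L0_dzbar X) (- 6 * cnj z * (1 - z * cnj z) * reflected_cauchy 4 X z) b z"
      by (metis has_wirtinger_L0_dz[OF assms z] has_wirtinger_L0_dzbar[OF assms z])
    then show ?thesis
      using one_minus_mult_cnj_ne_0[OF z]
      by (intro tension_section_of_eq_0[OF z has_wirtinger_L0[OF assms] ab])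
        (simp_all add: L0_dzbar_def \<phi>_def power2_eq_square)
  qed
  moreover have "lagrangian_section (L0 X)"
    by (rule lagrangian_sectionI[OF has_wirtinger_L0[OF assms] Re_L0_dz_eq_0[OF assms]])
  ultimately show ?thesis
    using smooth_on_L0[OF assms] by (simp add: harmonic_lagrangian_def harmonic_map_on_def)
qed

end
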